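(* Let $p$ be an odd prime and $\alpha,z\in\mathbb Z_p$. Then $$ \bigg({}_2F_1\bigg[\begin{matrix}\alpha&1-\alpha\\&1\end{matrix}\bigg|\,z\bigg]_{p-1}\bigg)^2\equiv{}_3F_2\bigg[\begin{matrix}\alpha&1-\alpha&\frac12\\&1&1\end{matrix}\bigg|\,4z(1-z)\bigg]_{p-1}\pmod{p^2}. $$
   Context: $\mathbb Z_p$ denotes the $p$-adic integers. Pochhammer symbol: $(x)_0=1$, $(x)_k=x(x+1)\cdots(x+k-1)$. For $n\ge 0$ the truncated hypergeometric series is ${}_{m+1}F_m\Big[\begin{matrix}\alpha_0&\alpha_1&\ldots&\alpha_m\\&\beta_1&\ldots&\beta_m\end{matrix}\Big|\,z\Big]_n=\sum_{k=0}^{n}\frac{(\alpha_0)_k\cdots(\alpha_m)_k}{(\beta_1)_k\cdots(\beta_m)_k}\cdot\frac{z^k}{k!}$. For $x,y\in\mathbb Z_p$, $x\equiv y\pmod{p^2}$ means $x-y\in p^2\mathbb Z_p$. *)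

theory Defs
  imports "HOL-Number_Theory.Cong" "HOL-Computational_Algebra.Primes" "HOL-Algebra.Ideal"
begin

text \<open>
  The $p$-adic integers as the inverse limit of the rings \<open>\<int>/p\<^sup>n\<int>\<close>: the element \<open>x\<close> is the sequence
  of its residues, \<open>x n\<close> being the representative of \<open>x\<close> modulo \<open>p\<^sup>n\<close> in \<open>{0..<p\<^sup>n}\<close>.
\<close>

definition padic_int :: "nat \<Rightarrow> (nat \<Rightarrow> int) ring"
  where "padic_int p =
    \<lparr>carrier = {x. \<forall>n. x n \<in> {0..<int p ^ n} \<and> x (Suc n) mod int p ^ n = x n},
     monoid.mult = (\<lambda>x y n. (x n * y n) mod int p ^ n),
     one = (\<lambda>n. 1 mod int p ^ n),
     zero = (\<lambda>n. 0),
     add = (\<lambda>x y n. (x n + y n) mod int p ^ n)\<rparr>"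

definition padic_cong :: "nat \<Rightarrow> nat \<Rightarrow> (nat \<Rightarrow> int) \<Rightarrow> (nat \<Rightarrow> int) \<Rightarrow> bool"
  where "padic_cong p m x y \<longleftrightarrow>
    x \<ominus>\<^bsub>padic_int p\<^esub> y \<in> PIdl\<^bsub>padic_int p\<^esub> ([(p ^ m)] \<cdot>\<^bsub>padic_int p\<^esub> \<one>\<^bsub>padic_int p\<^esub>)"

primrec ring_pochhammer :: "('a, 'm) ring_scheme \<Rightarrow> 'a \<Rightarrow> nat \<Rightarrow> 'a"
  where
    "ring_pochhammer R x 0 = \<one>\<^bsub>R\<^esub>"
  | "ring_pochhammer R x (Suc k) = ring_pochhammer R x k \<otimes>\<^bsub>R\<^esub> (x \<oplus>\<^bsub>R\<^esub> [k] \<cdot>\<^bsub>R\<^esub> \<one>\<^bsub>R\<^esub>)"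

definition list_pochhammer :: "('a, 'm) ring_scheme \<Rightarrow> 'a list \<Rightarrow> nat \<Rightarrow> 'a"
  where "list_pochhammer R as k = foldr (\<lambda>a y. ring_pochhammer R a k \<otimes>\<^bsub>R\<^esub> y) as \<one>\<^bsub>R\<^esub>"

text \<open>
  The truncated hypergeometric series, with upper parameters \<open>as\<close>, lower parameters \<open>bs\<close> and
  argument \<open>z\<close>. Division is multiplication by the inverse in \<open>R\<close>, so this is meaningful when the
  denominators are units. For lower parameters \<open>1\<close> they are powers of \<open>k!\<close>, which is a unit of
  \<open>padic_int p\<close> for \<open>k < p\<close> and \<open>p\<close> prime by the lemma \<open>padic_int_of_nat_Units\<close> below.
\<close>

definition hypergeom_trunc ::
    "('a, 'm) ring_scheme \<Rightarrow> 'a list \<Rightarrow> 'a list \<Rightarrow> 'a \<Rightarrow> nat \<Rightarrow> 'a"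
  where "hypergeom_trunc R as bs z n =
    (\<Oplus>\<^bsub>R\<^esub>k\<in>{0..n}.
       (list_pochhammer R as k \<otimes>\<^bsub>R\<^esub> inv\<^bsub>R\<^esub> (list_pochhammer R bs k))
       \<otimes>\<^bsub>R\<^esub> (z [^]\<^bsub>R\<^esub> k \<otimes>\<^bsub>R\<^esub> inv\<^bsub>R\<^esub> ([(fact k :: nat)] \<cdot>\<^bsub>R\<^esub> \<one>\<^bsub>R\<^esub>)))"

lemma padic_int_cong:
  assumes "x \<in> carrier (padic_int p)"
  shows "[x (Suc n) = x n] (mod int p ^ n)"
  using assms by (simp add: padic_int_def cong_def)

lemma padic_int_carrierI:
  assumes "p > 0" "\<And>n. [f (Suc n) = f n] (mod int p ^ n)"
  shows "(\<lambda>n. f n mod int p ^ n) \<in> carrier (padic_int p)"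
  using assms by (simp add: padic_int_def cong_def mod_mod_cancel)

lemma padic_int_cring:
  assumes "p > 0"
  shows "cring (padic_int p)"
proof (rule cringI)
  let ?R = "padic_int p"
  have add: "x \<oplus>\<^bsub>?R\<^esub> y \<in> carrier ?R" if "x \<in> carrier ?R" "y \<in> carrier ?R" for x y
    using padic_int_carrierI[OF assms, of "\<lambda>n. x n + y n"] that
    by (simp add: cong_add padic_int_cong) (simp add: padic_int_def)
  have mult: "x \<otimes>\<^bsub>?R\<^esub> y \<in> carrier ?R" if "x \<in> carrier ?R" "y \<in> carrier ?R" for x y
    using padic_int_carrierI[OF assms, of "\<lambda>n. x n * y n"] that
    by (simp add: cong_mult padic_int_cong) (simp add: padic_int_def)
  have one: "\<one>\<^bsub>?R\<^esub> \<in> carrier ?R"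
    using padic_int_carrierI[OF assms, of "\<lambda>n. 1"] by (simp add: padic_int_def)
  have neg: "\<exists>y\<in>carrier ?R. y \<oplus>\<^bsub>?R\<^esub> x = \<zero>\<^bsub>?R\<^esub>" if "x \<in> carrier ?R" for x
    using padic_int_carrierI[OF assms, of "\<lambda>n. - x n"] that
    by (intro bexI[of _ "\<lambda>n. (- x n) mod int p ^ n"])
      (simp_all add: cong_minus_minus_iff padic_int_cong, simp add: padic_int_def mod_simps)
  have zero: "\<zero>\<^bsub>?R\<^esub> \<in> carrier ?R"
    using assms by (simp add: padic_int_def)
  show "abelian_group ?R"
    by (rule abelian_groupI)
      (use add zero neg in \<open>auto simp: padic_int_def mod_simps algebra_simps\<close>)
  show "comm_monoid ?R"
    by (rule comm_monoidI)
      (use mult one in \<open>auto simp: padic_int_def mod_simps algebra_simps\<close>)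
  show "(x \<oplus>\<^bsub>?R\<^esub> y) \<otimes>\<^bsub>?R\<^esub> z = x \<otimes>\<^bsub>?R\<^esub> z \<oplus>\<^bsub>?R\<^esub> y \<otimes>\<^bsub>?R\<^esub> z" for x y z
    by (auto simp: padic_int_def mod_simps algebra_simps)
qed

lemma padic_int_of_nat:
  "[k] \<cdot>\<^bsub>padic_int p\<^esub> \<one>\<^bsub>padic_int p\<^esub> = (\<lambda>n. int k mod int p ^ n)"
  by (induction k)
    (auto simp: add_pow_def nat_pow_def padic_int_def fun_eq_iff mod_simps algebra_simps)

lemma padic_int_of_nat_Units:
  assumes "p > 0" "coprime k p"
  shows "[k] \<cdot>\<^bsub>padic_int p\<^esub> \<one>\<^bsub>padic_int p\<^esub> \<in> Units (padic_int p)"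
proof -
  interpret cring "padic_int p" using assms(1) by (rule padic_int_cring)
  have "\<exists>a. [int k * a = 1] (mod int p ^ n)" for n
    using assms(2) by (intro cong_solve_coprime_int) simp
  then obtain g where g: "\<And>n. [int k * g n = 1] (mod int p ^ n)" by metis
  have "[g (Suc n) = g n] (mod int p ^ n)" for n
  proof -
    have "[int k * g (Suc n) = 1] (mod int p ^ n)"
      using g[of "Suc n"] by (rule cong_dvd_modulus) simp
    then have "[int k * g (Suc n) = int k * g n] (mod int p ^ n)"
      using g[of n] cong_sym cong_trans by blast
    then show ?thesis using assms(2) by (simp add: cong_mult_lcancel)
  qed
  then have c: "(\<lambda>n. g n mod int p ^ n) \<in> carrier (padic_int p)"
    by (rule padic_int_carrierI[OF assms(1)])
  have e: "(\<lambda>n. g n mod int p ^ n) \<otimes>\<^bsub>padic_int p\<^esub> ([k] \<cdot>\<^bsub>padic_int p\<^esub> \<one>\<^bsub>padic_int p\<^esub>)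
        = \<one>\<^bsub>padic_int p\<^esub>"
    using g unfolding padic_int_of_nat
    by (simp add: padic_int_def fun_eq_iff mod_simps cong_def mult.commute)
  have k: "[k] \<cdot>\<^bsub>padic_int p\<^esub> \<one>\<^bsub>padic_int p\<^esub> \<in> carrier (padic_int p)"
    by simp
  show ?thesis
    unfolding Units_def using c e k m_comm[OF c k] by auto
qed

end

theory Submission
  imports Defs "HOL-Computational_Algebra.Polynomial"
begin

text \<open>
  Modulo \<open>p\<^sup>2\<close> the parameter \<open>\<alpha>\<close> may be replaced by an integer \<open>-n\<close> with \<open>n \<ge> 0\<close>. The full series
  for \<open>-n\<close> are polynomials in \<open>z\<close>, and Clausen's identity between them holds because both
  sides solve the symmetric square of the Legendre equation. Truncation after \<open>p - 1\<close> does not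
  affect the coefficients of \<open>z\<^sup>m\<close> with \<open>m < p\<close>, while for \<open>m \<ge> p\<close> all contributions on
  either side are divisible by \<open>p\<^sup>2\<close>: with \<open>a = n mod p\<close>, the prime \<open>p\<close> divides \<open>n choose k\<close>
  for \<open>a < k < p\<close> and \<open>(n + k) choose k\<close> for \<open>p - 1 - a < k < p\<close>.
\<close>

section \<open>The polynomial z(1 - z) and the integer coefficients for the parameter -n\<close>

text \<open>It has two roles: the argument of the 3F2 side without its factor 4, and the leading
  coefficient of the Legendre equation \<open>pderiv (w * pderiv f) = smult c f\<close>.\<close>

definition clausen_arg :: "int poly"
  where "clausen_arg = [:0, 1, -1:]"

text \<open>The coefficient \<open>(-n)\<^sub>k (1 + n)\<^sub>k / (k!)\<^sup>2\<close>, written so that it is visibly an integer.\<close>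

definition legendre_coeff :: "nat \<Rightarrow> nat \<Rightarrow> int"
  where "legendre_coeff n k = (-1) ^ k * int (n choose k) * int ((n + k) choose k)"

lemma legendre_coeff_0 [simp]: "legendre_coeff n 0 = 1"
  by (simp add: legendre_coeff_def)

lemma legendre_coeff_eq_0: "n < k \<Longrightarrow> legendre_coeff n k = 0"
  by (simp add: legendre_coeff_def)

lemma legendre_coeff_Suc:
  "(int k + 1)\<^sup>2 * legendre_coeff n (Suc k) = (int k - int n) * (int n + 1 + int k) * legendre_coeff n k"
proof -
  have 1: "(int k + 1) * int (n choose Suc k) = (int n - int k) * int (n choose k)"
  \<comment> \<open>The natural-number difference \<open>n - k\<close> is faithful only for
    \<open>k \<le> n\<close>; beyond that both binomials vanish.\<close>
  proof (cases "k \<le> n")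
    case True
    have "int (Suc k * (n choose Suc k)) = int ((n - k) * (n choose k))"
      by (simp only: binomial_absorption binomial_absorb_comp)
    then show ?thesis using True by (simp add: of_nat_diff algebra_simps)
  qed (simp add: binomial_eq_0)
  have "int (Suc k * (Suc (n + k) choose Suc k)) = int (Suc (n + k) * ((n + k) choose k))"
    by (simp only: Suc_times_binomial)
  then have 2: "(int k + 1) * int ((n + Suc k) choose Suc k) = (int n + 1 + int k) * int ((n + k) choose k)"
    by (simp add: algebra_simps del: binomial_Suc_Suc)
  have "(int k + 1)\<^sup>2 * legendre_coeff n (Suc k)
      = - ((-1) ^ k * ((int k + 1) * int (n choose Suc k)) * ((int k + 1) * int ((n + Suc k) choose Suc k)))"
    by (simp add: legendre_coeff_def power2_eq_square mult_ac del: binomial_Suc_Suc)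
  also have "\<dots> = (int k - int n) * (int n + 1 + int k) * legendre_coeff n k"
    unfolding 1 2 legendre_coeff_def by (simp add: algebra_simps)
  finally show ?thesis .
qed

lemma fact_sq_legendre_coeff:
  "(fact k)\<^sup>2 * legendre_coeff n k = pochhammer (- int n) k * pochhammer (1 + int n) k"
proof (induction k)
  case (Suc k)
  have "(fact (Suc k))\<^sup>2 * legendre_coeff n (Suc k) = (fact k)\<^sup>2 * ((int k + 1)\<^sup>2 * legendre_coeff n (Suc k))"
    by (simp add: power2_eq_square algebra_simps)
  also have "\<dots> = ((fact k)\<^sup>2 * legendre_coeff n k) * ((int k - int n) * (int n + 1 + int k))"
    unfolding legendre_coeff_Suc by (simp only: mult_ac)
  finally show ?case
    unfolding Suc by (simp add: pochhammer_Suc algebra_simps)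
qed simp

lemma fact_sq_central_binomial: "(fact k)\<^sup>2 * ((2 * k) choose k) = (fact (2 * k) :: nat)"
  using binomial_fact_lemma[of k "2 * k"] by (simp add: power2_eq_square mult_2)

text \<open>Multiplied by (k!)^2 (k + 1), both sides become (2k + 2)!.\<close>

lemma central_binomial_Suc:
  "(k + 1) * ((2 * Suc k) choose Suc k) = 2 * (2 * k + 1) * ((2 * k) choose k)"
proof -
  have "(fact k)\<^sup>2 * (k + 1) * ((k + 1) * ((2 * Suc k) choose Suc k)) = (fact (2 * Suc k) :: nat)"
    unfolding fact_sq_central_binomial[symmetric] by (simp add: power2_eq_square algebra_simps)
  also have "\<dots> = (fact k)\<^sup>2 * (k + 1) * (2 * (2 * k + 1) * ((2 * k) choose k))"
    using fact_sq_central_binomial[of k] by (simp add: algebra_simps)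
  finally show ?thesis by (metis mult_cancel_left fact_nonzero power_not_zero Suc_eq_plus1 nat.distinct(1) mult_eq_0_iff)
qed

section \<open>The Legendre equation and its symmetric square\<close>

lemma coeff_clausen_arg_mult:
  "coeff (clausen_arg * q) m =
     (if m \<ge> 1 then coeff q (m - 1) else 0) - (if m \<ge> 2 then coeff q (m - 2) else 0)"
proof -
  have "clausen_arg * q = pCons 0 (q - pCons 0 q)"
    by (simp add: clausen_arg_def)
  then show ?thesis
    by (simp add: coeff_pCons eval_nat_numeral split: nat.split)
qed

lemma coeff_pderiv_clausen_arg_mult:
  "coeff (pderiv (clausen_arg * q)) m
     = (int m + 1) * (coeff q m - (if m \<ge> 1 then coeff q (m - 1) else 0))"
  by (simp add: coeff_pderiv coeff_clausen_arg_mult eval_nat_numeral)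

text \<open>Comparison with \<open>smult c q\<close> gives (m + 1)^2 q_(m+1) = (m(m + 1) + c) q_m.
  For c = -n(n + 1) the bracket is (m - n)(n + 1 + m), which is the recurrence
  \<open>legendre_coeff_Suc\<close>.\<close>

lemma coeff_legendre_operator:
  "coeff (pderiv (clausen_arg * pderiv q)) m
     = (int m + 1)\<^sup>2 * coeff q (Suc m) - int m * (int m + 1) * coeff q m"
  unfolding coeff_pderiv_clausen_arg_mult
  by (cases m) (simp_all add: coeff_pderiv power2_eq_square algebra_simps)

text \<open>In the coefficient of z^k the left side contains d_(k+1) with the factor (k + 1)^3,
  while all other terms on both sides involve only d_0, ..., d_k. Hence a solution is determined by
  its constant term.\<close>

lemma clausen_ode_unique:
  fixes d :: "int poly"
  assumes ode: "pderiv (clausen_arg * pderiv (clausen_arg * pderiv d))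
      = smult (2 * c) (pderiv clausen_arg * d) + smult (4 * c) (clausen_arg * pderiv d)"
    and "coeff d 0 = 0"
  shows "d = 0"
proof -
  have "coeff d m = 0" for m
  proof (induction m rule: less_induct)
    case (less m)
    show ?case
    proof (cases m)
      case (Suc k)
      have z: "coeff d j = 0" if "j \<le> k" for j
        using less Suc that by simp
      have "coeff (pderiv (clausen_arg * pderiv (clausen_arg * pderiv d))) k = (int k + 1) ^ 3 * coeff d (Suc k)"
        unfolding coeff_pderiv_clausen_arg_mult[of "pderiv (clausen_arg * pderiv d)"]
        unfolding coeff_legendre_operator by (simp add: z power2_eq_square power3_eq_cube algebra_simps)
      moreover have "coeff (clausen_arg * pderiv d) k = 0"
        using z by (auto simp: coeff_clausen_arg_mult coeff_pderiv)
      moreover have "coeff (pderiv clausen_arg * d) k = 0"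
        using z by (auto simp: coeff_mult intro!: sum.neutral)
      ultimately show ?thesis
        using Suc unfolding ode by simp
    qed (use assms in simp)
  qed
  then show ?thesis by (simp add: poly_eq_iff)
qed

text \<open>With g = w f' one has g' = c f, so w (f^2)' = 2 f g and w (w (f^2)')' = 2 (g^2 + c w
  f^2). Differentiating once more and using g = w f' again gives the claim, for any
  \<open>w\<close>.\<close>

lemma clausen_ode_square:
  fixes f :: "int poly"
  assumes ode: "pderiv (w * pderiv f) = smult c f"
  shows "pderiv (w * pderiv (w * pderiv (f\<^sup>2)))
      = smult (2 * c) (pderiv w * f\<^sup>2) + smult (4 * c) (w * pderiv (f\<^sup>2))"
proof -
  \<comment> \<open>As a constant polynomial, \<open>c\<close> takes part in ring normalisation,
    which \<open>smult\<close> would obstruct.\<close>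
  define C where "C = [:c:]"
  have C: "smult c q = C * q" "pderiv C = 0" for q
    by (simp_all add: C_def)
  have C2: "smult (2 * c) q = 2 * C * q" "smult (4 * c) q = 4 * C * q" for q
    by (simp_all add: C_def numeral_poly mult.commute)
  define g where "g = w * pderiv f"
  have g: "pderiv g = C * f" using ode by (simp add: g_def C)
  have sq: "pderiv (f\<^sup>2) = 2 * f * pderiv f" by (simp add: power2_eq_square pderiv_mult)
  have "w * pderiv (f\<^sup>2) = 2 * (f * g)" unfolding sq g_def by (simp add: algebra_simps)
  then have "pderiv (w * pderiv (f\<^sup>2)) = pderiv (2 * (f * g))" by (simp only:)
  then have 1: "pderiv (w * pderiv (f\<^sup>2)) = 2 * (pderiv f * g + C * f\<^sup>2)"
    unfolding pderiv_mult g by (simp add: power2_eq_square algebra_simps)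
  have "w * pderiv (w * pderiv (f\<^sup>2)) = 2 * (g * g + C * (w * f\<^sup>2))"
    unfolding 1 g_def by (simp add: algebra_simps power2_eq_square)
  then have "pderiv (w * pderiv (w * pderiv (f\<^sup>2))) = pderiv (2 * (g * g + C * (w * f\<^sup>2)))"
    by (simp only:)
  also have "\<dots> = 2 * (2 * g * C * f + C * (pderiv w * f\<^sup>2 + w * (2 * f * pderiv f)))"
    unfolding pderiv_mult pderiv_add sq g C(2) by (simp add: algebra_simps)
  finally show ?thesis unfolding C2 sq g_def by (simp add: algebra_simps power2_eq_square)
qed

text \<open>Since w = z(1 - z) satisfies w'^2 = 1 - 4w and w'' = -2, the operator sends w^k to w'
  times a combination of only two powers of w, so series in w obey a two-term recurrence. For k = 0
  the truncated exponent \<open>k - 1\<close> is harmless, as its factor k^3 is 0.\<close>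

lemma clausen_operator_power:
  "pderiv (clausen_arg * pderiv (clausen_arg * pderiv (clausen_arg ^ k)))
    = pderiv clausen_arg * (of_nat (k ^ 3) * clausen_arg ^ (k - 1)
        - of_nat (2 * k * (2 * k + 1) * (k + 1)) * clausen_arg ^ k)"
proof -
  let ?w = clausen_arg and ?w' = "pderiv clausen_arg"
  have w': "?w'\<^sup>2 = 1 - 4 * ?w" "pderiv ?w' = - 2"
    by (simp_all add: clausen_arg_def pderiv_pCons power2_eq_square numeral_poly one_pCons)
  have dpow: "pderiv (?w ^ j) = of_nat j * ?w ^ (j - 1) * ?w'" for j
    by (simp add: pderiv_power of_nat_poly)
  have pow: "?w * pderiv (?w ^ j) = of_nat j * ?w ^ j * ?w'" for j
    unfolding dpow by (cases j) (simp_all add: algebra_simps)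
  have nat0: "pderiv (of_nat j :: int poly) = 0" for j
    by (simp add: of_nat_poly)
  have "pderiv (?w * pderiv (?w ^ k)) = of_nat k * (pderiv (?w ^ k) * ?w' + ?w ^ k * pderiv ?w')"
    unfolding pow by (simp add: pderiv_mult nat0 algebra_simps)
  then have "?w * pderiv (?w * pderiv (?w ^ k)) = of_nat k * ((?w * pderiv (?w ^ k)) * ?w' + ?w * ?w ^ k * pderiv ?w')"
    by (simp only: distrib_left mult_ac)
  also have "\<dots> = of_nat (k\<^sup>2) * ?w ^ k * ?w'\<^sup>2 - of_nat (2 * k) * ?w ^ Suc k"
    unfolding pow[of k] w'(2) by (simp add: power2_eq_square algebra_simps)
  also have "\<dots> = of_nat (k\<^sup>2) * ?w ^ k - of_nat (2 * k * (2 * k + 1)) * ?w ^ Suc k"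
    unfolding w'(1) by (simp add: power2_eq_square algebra_simps)
  finally have 1: "?w * pderiv (?w * pderiv (?w ^ k)) = \<dots>" .
  show ?thesis
    unfolding 1 unfolding pderiv_diff pderiv_mult nat0 dpow
    by (simp add: power2_eq_square power3_eq_cube algebra_simps)
qed

section \<open>Clausen's identity for integer polynomials\<close>

lemma pderiv_sum: "pderiv (sum f A) = (\<Sum>x\<in>A. pderiv (f x :: 'a :: idom poly))"
  using higher_pderiv_sum[of 1 f A] by simp

lemma smult_sum_right: "smult c (sum f A) = (\<Sum>x\<in>A. smult c (f x))"
  by (induction A rule: infinite_finite_induct) (simp_all add: smult_add_right)

text \<open>
  The binomial coefficient is \<open>4\<^sup>k (1/2)\<^sub>k / k!\<close>; the power of \<open>4\<close> comes from the argument \<open>4z(1 - z)\<close>.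
\<close>

definition clausen_coeff :: "nat \<Rightarrow> nat \<Rightarrow> int"
  where "clausen_coeff n k = legendre_coeff n k * int ((2 * k) choose k)"

text \<open>The product of \<open>legendre_coeff_Suc\<close> and
  \<open>central_binomial_Suc\<close>; it is what makes the sum in \<open>clausen_legendre\<close>
  telescope.\<close>

lemma clausen_coeff_Suc:
  "(int k + 1) ^ 3 * clausen_coeff n (Suc k)
     = 2 * (2 * int k + 1) * (int k - int n) * (int n + 1 + int k) * clausen_coeff n k"
proof -
  have "int ((k + 1) * ((2 * Suc k) choose Suc k)) = int (2 * (2 * k + 1) * ((2 * k) choose k))"
    by (simp only: central_binomial_Suc)
  then have c: "(int k + 1) * int ((2 * Suc k) choose Suc k) = 2 * (2 * int k + 1) * int ((2 * k) choose k)"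
    by (simp only: of_nat_mult of_nat_add of_nat_1 of_nat_numeral)
  have "(int k + 1) ^ 3 * clausen_coeff n (Suc k)
      = ((int k + 1)\<^sup>2 * legendre_coeff n (Suc k)) * ((int k + 1) * int ((2 * Suc k) choose Suc k))"
    by (simp only: clausen_coeff_def power2_eq_square power3_eq_cube mult_ac)
  then show ?thesis
    unfolding c legendre_coeff_Suc clausen_coeff_def by (simp only: mult_ac)
qed

text \<open>Uniqueness applies with c = -n(n + 1), since both sides take the value 1 at 0. The
  square satisfies the equation by \<open>clausen_ode_square\<close>; for the right side the defect
  telescopes to 0.\<close>

lemma clausen_legendre:
  "(\<Sum>k\<le>n. monom (legendre_coeff n k) k)\<^sup>2 = (\<Sum>k\<le>n. smult (clausen_coeff n k) (clausen_arg ^ k))"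
    (is "?f\<^sup>2 = ?g")
proof -
  let ?w = clausen_arg and ?w' = "pderiv clausen_arg"
  let ?c = "- int n * (int n + 1)"
  let ?b = "clausen_coeff n"
  have "coeff ?f m = legendre_coeff n m" for m
    by (simp add: coeff_sum legendre_coeff_eq_0)
  then have "pderiv (?w * pderiv ?f) = smult ?c ?f"
    using legendre_coeff_Suc
    by (intro poly_eqI) (simp add: coeff_legendre_operator algebra_simps)
  then have f: "pderiv (?w * pderiv (?w * pderiv (?f\<^sup>2)))
      = smult (2 * ?c) (?w' * ?f\<^sup>2) + smult (4 * ?c) (?w * pderiv (?f\<^sup>2))"
    by (rule clausen_ode_square)
  have lin: "pderiv (?w * pderiv (?w * pderiv ?g))
     = (\<Sum>k\<le>n. smult (?b k) (pderiv (?w * pderiv (?w * pderiv (?w ^ k)))))"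
    by (simp add: pderiv_sum pderiv_smult sum_distrib_left)
  \<comment> \<open>Up to the factor w', \<open>t k\<close> is the lower-power part of the operator
    applied to the k-th term of \<open>?g\<close>. The rest of the defect of that term is minus
    \<open>t (Suc k)\<close>, by \<open>clausen_coeff_Suc\<close>.\<close>
  define t where "t k = smult (int (k ^ 3) * ?b k) (?w ^ (k - 1))" for k
  have step: "smult (?b k) (pderiv (?w * pderiv (?w * pderiv (?w ^ k))))
     - smult (2 * ?c * ?b k) (?w' * ?w ^ k) - smult (4 * ?c * ?b k) (?w * pderiv (?w ^ k))
     = ?w' * (t k - t (Suc k))" for k
  proof -
    have of_nat: "of_nat j * q = smult (int j) q" for j and q :: "int poly"
      by (simp add: of_nat_poly)
    define P where "P = ?w' * ?w ^ (k - 1)"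
    define Q where "Q = ?w' * ?w ^ k"
    have P: "smult (?b k) (pderiv (?w * pderiv (?w * pderiv (?w ^ k))))
        = smult (int (k ^ 3) * ?b k) P - smult (int (2 * k * (2 * k + 1) * (k + 1)) * ?b k) Q"
      unfolding clausen_operator_power P_def Q_def of_nat
      by (simp add: right_diff_distrib smult_diff_right mult.commute)
    have Q: "?w * pderiv (?w ^ k) = smult (int k) Q"
      unfolding pderiv_power Q_def by (cases k) (simp_all add: mult_ac)
    have t: "?w' * t k = smult (int (k ^ 3) * ?b k) P"
      by (simp add: t_def P_def)
    have "?w' * t (Suc k) = smult (2 * (2 * int k + 1) * (int k - int n) * (int n + 1 + int k) * ?b k) Q"
      unfolding clausen_coeff_Suc[symmetric] by (simp add: t_def Q_def add.commute)
    \<comment> \<open>Here (k - n)(n + 1 + k) = k(k + 1) + c; multiplied by 2(2k + 1), this splits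
      into the part from the operator and the two terms on the right of the equation.\<close>
    also have "2 * (2 * int k + 1) * (int k - int n) * (int n + 1 + int k) * ?b k
        = int (2 * k * (2 * k + 1) * (k + 1)) * ?b k + (2 * ?c * ?b k + 4 * ?c * ?b k * int k)"
      by (simp add: algebra_simps)
    finally have t': "?w' * t (Suc k) = smult \<dots> Q" .
    show ?thesis
      unfolding P unfolding Q Q_def[symmetric] right_diff_distrib t t'
      by (simp only: smult_add_left smult_smult diff_diff_eq add.assoc)
  qed
  have "pderiv (?w * pderiv (?w * pderiv ?g)) - smult (2 * ?c) (?w' * ?g) - smult (4 * ?c) (?w * pderiv ?g)
     = (\<Sum>k\<le>n. ?w' * (t k - t (Suc k)))"
    unfolding lin step[symmetric] sum_subtractf
    by (simp add: pderiv_sum pderiv_smult sum_distrib_left smult_sum_right)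
  also have "\<dots> = ?w' * (t 0 - t (Suc n))"
    by (simp only: sum_distrib_left[symmetric] sum_telescope)
  \<comment> \<open>\<open>t 0\<close> carries the factor 0^3, and \<open>t (Suc n)\<close> a
    coefficient beyond index \<open>n\<close>.\<close>
  also have "t 0 - t (Suc n) = 0"
    by (simp add: t_def clausen_coeff_def legendre_coeff_eq_0)
  finally have g: "pderiv (?w * pderiv (?w * pderiv ?g))
      = smult (2 * ?c) (?w' * ?g) + smult (4 * ?c) (?w * pderiv ?g)"
    by (simp add: algebra_simps)
  have "?f\<^sup>2 - ?g = 0"
  proof (rule clausen_ode_unique)
    show "pderiv (?w * pderiv (?w * pderiv (?f\<^sup>2 - ?g)))
      = smult (2 * ?c) (?w' * (?f\<^sup>2 - ?g)) + smult (4 * ?c) (?w * pderiv (?f\<^sup>2 - ?g))"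
      using f g by (simp only: pderiv_diff right_diff_distrib smult_diff_right)
    have "poly ?w 0 = 0" by (simp add: clausen_arg_def)
    then have "poly ?g 0 = 1"
      by (simp add: poly_sum power_0_left if_distrib clausen_coeff_def cong: if_cong)
    moreover have "poly ?f 0 = 1"
      by (simp add: poly_sum poly_monom power_0_left if_distrib cong: if_cong)
    ultimately show "coeff (?f\<^sup>2 - ?g) 0 = 0"
      by (simp add: poly_0_coeff_0[symmetric])
  qed
  then show ?thesis by simp
qed

section \<open>Divisibility of the coefficients by p and p^2\<close>

text \<open>In (k + 1) C(n, k + 1) = (n - k) C(n, k) the prime enters at k = n mod p, where it
  divides n - k. It is then passed on, because k + 1 < p is prime to p.\<close>

lemma prime_dvd_binomial_residue:
  fixes p :: nat
  assumes p: "prime p"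
  shows "n mod p < k \<Longrightarrow> k < p \<Longrightarrow> p dvd n choose k"
proof (induction k)
  case (Suc k)
  have "Suc k * (n choose Suc k) = (n - k) * (n choose k)"
    by (simp only: binomial_absorption binomial_absorb_comp)
  moreover have "p dvd (n - k) * (n choose k)"
  proof (cases "n mod p = k")
    case True
    then have "p dvd n - k" by (metis dvd_minus_mod)
    then show ?thesis by simp
  qed (use Suc in auto)
  ultimately have "p dvd Suc k * (n choose Suc k)" by simp
  moreover have "\<not> p dvd Suc k" using Suc.prems by (auto dest: dvd_imp_le)
  ultimately show ?case using p prime_dvd_mult_iff by blast
qed simp

text \<open>The relation is now (k + 1) C(n + k + 1, k + 1) = (n + k + 1) C(n + k, k), and the prime
  enters when n mod p + k + 1 = p.\<close>

lemma prime_dvd_binomial_add_residue: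
  fixes p :: nat
  assumes p: "prime p"
  shows "p \<le> n mod p + k \<Longrightarrow> k < p \<Longrightarrow> p dvd (n + k) choose k"
proof (induction k)
  case 0
  then show ?case using mod_less_divisor[OF prime_gt_0_nat[OF p], of n] by simp
next
  case (Suc k)
  have "Suc k * ((n + Suc k) choose Suc k) = Suc (n + k) * ((n + k) choose k)"
    using Suc_times_binomial[of k "n + k"] by simp
  moreover have "p dvd Suc (n + k) * ((n + k) choose k)"
  proof (cases "n mod p + Suc k = p")
    case True
    have "Suc (n + k) = p * (n div p) + (n mod p + Suc k)" by simp
    then have "p dvd Suc (n + k)" unfolding True by (metis dvd_add dvd_refl dvd_triv_left)
    then show ?thesis by (rule dvd_mult2)
  next
    case False
    then have "p dvd (n + k) choose k" using Suc by simp
    then show ?thesis by (rule dvd_mult)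
  qed
  ultimately have "p dvd Suc k * ((n + Suc k) choose Suc k)" by (simp only:)
  moreover have "\<not> p dvd Suc k" using Suc.prems by (auto dest: dvd_imp_le)
  ultimately show ?case using p prime_dvd_mult_iff by blast
qed

text \<open>For k, l < p with p \<le> k + l, either n mod p < k and p divides C(n, k), or p \<le> n
  mod p + l and p divides C(n + l, l). Used for (i, j) and (j, i), this yields two factors
  p.\<close>

lemma prime_sq_dvd_legendre_coeff_mult:
  fixes p :: nat
  assumes p: "prime p" and "i < p" "j < p" "p \<le> i + j"
  shows "(int p)\<^sup>2 dvd legendre_coeff n i * legendre_coeff n j"
proof -
  let ?A = "\<lambda>k. n choose k" and ?B = "\<lambda>k. (n + k) choose k"
  have "p dvd ?A k \<or> p dvd ?B l" if "k < p" "l < p" "p \<le> k + l" for k l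
  proof (cases "n mod p < k")
    case False
    then have "p \<le> n mod p + l" using that by simp
    then show ?thesis using prime_dvd_binomial_add_residue[OF p] that by simp
  qed (use prime_dvd_binomial_residue[OF p] that in simp)
  \<comment> \<open>The two applications concern different factors of the product,
    \<open>?A i\<close> or \<open>?B j\<close> and \<open>?A j\<close> or \<open>?B i\<close>, so
    the primes multiply even for \<open>i = j\<close>.\<close>
  from this[of i j] this[of j i] have "p * p dvd ?A i * ?B i * (?A j * ?B j)"
    using assms by (auto simp: add.commute intro: mult_dvd_mono dvd_mult dvd_mult2
        elim!: dvdE)
  then have "int (p * p) dvd int (?A i * ?B i * (?A j * ?B j))"
    by (simp only: of_nat_dvd_iff)
  then have "(int p)\<^sup>2 dvd (-1) ^ (i + j) * int (?A i * ?B i * (?A j * ?B j))"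
    by (simp add: power2_eq_square)
  also have "\<dots> = legendre_coeff n i * legendre_coeff n j"
    by (simp add: legendre_coeff_def power_add mult_ac)
  finally show ?thesis .
qed

text \<open>One factor p comes from the central binomial coefficient, the other from
  \<open>legendre_coeff n k\<close>, whose square is divisible by p^2.\<close>

lemma prime_sq_dvd_clausen_coeff:
  fixes p :: nat
  assumes p: "prime p" and k: "k < p" "p \<le> 2 * k"
  shows "(int p)\<^sup>2 dvd clausen_coeff n k"
proof -
  have "p dvd (k + k) choose k"
    using k by (intro prime_dvd_binomial_add_residue[OF p]) simp_all
  then have 1: "int p dvd int ((2 * k) choose k)" by (simp add: mult_2)
  have "int p * int p dvd legendre_coeff n k * legendre_coeff n k"
    using prime_sq_dvd_legendre_coeff_mult[OF p, of k k n] k by (simp add: power2_eq_square)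
  then have "int p dvd legendre_coeff n k"
    using p by (metis dvd_mult_left prime_dvd_mult_iff prime_nat_int_transfer)
  then show ?thesis
    using 1 unfolding clausen_coeff_def power2_eq_square by (rule mult_dvd_mono)
qed

section \<open>The truncated congruence over the integers\<close>

lemma coeff_clausen_arg_power_eq_0: "m < k \<Longrightarrow> coeff (clausen_arg ^ k) m = 0"
proof -
  assume "m < k"
  have "clausen_arg = monom 1 1 * [:1, -1:]"
    by (simp add: clausen_arg_def monom_altdef)
  then have "clausen_arg ^ k = monom 1 1 ^ k * [:1, -1:] ^ k"
    by (metis power_mult_distrib)
  also have "monom 1 1 ^ k = (monom 1 k :: int poly)" by (simp add: monom_power)
  finally have "clausen_arg ^ k = monom 1 k * [:1, -1:] ^ k" .
  then show ?thesis using \<open>m < k\<close> by (simp add: coeff_monom_mult)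
qed

text \<open>Divisibility by p^2 is shown for every coefficient of the difference as a polynomial;
  evaluation at the integer \<open>z\<close> comes last.\<close>

lemma clausen_truncated_cong:
  fixes p :: nat and z :: int
  assumes p: "prime p"
  shows "[(\<Sum>k<p. legendre_coeff n k * z ^ k)\<^sup>2
    = (\<Sum>k<p. clausen_coeff n k * (z * (1 - z)) ^ k)] (mod (int p)\<^sup>2)"
proof -
  define T where "T = (\<Sum>k<p. monom (legendre_coeff n k) k)"
  define S where "S = (\<Sum>k<p. smult (clausen_coeff n k) (clausen_arg ^ k))"
  define f where "f = (\<Sum>k\<le>n. monom (legendre_coeff n k) k)"
  have T: "coeff T k = (if k < p then legendre_coeff n k else 0)" for k
    by (simp add: T_def coeff_sum)
  have f: "coeff f k = legendre_coeff n k" for k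
    by (simp add: f_def coeff_sum legendre_coeff_eq_0)
  have "(int p)\<^sup>2 dvd coeff (T\<^sup>2 - S) m" for m
  proof (cases "m < p")
    case True
    have "coeff (T\<^sup>2) m = coeff (f\<^sup>2) m"
      unfolding power2_eq_square coeff_mult using True by (intro sum.cong) (auto simp: T f)
    \<comment> \<open>The identity sums up to n, \<open>S\<close> up to p - 1. Terms with k \<ge> p
      drop out because w^k starts in degree k > m; terms with k > n may be added because their
      coefficient is 0.\<close>
    also have "\<dots> = (\<Sum>k\<le>n. clausen_coeff n k * coeff (clausen_arg ^ k) m)"
      unfolding f_def clausen_legendre by (simp add: coeff_sum)
    also have "\<dots> = (\<Sum>k\<in>{..n} \<inter> {..<p}. clausen_coeff n k * coeff (clausen_arg ^ k) m)"
    proof (intro sum.mono_neutral_right ballI)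
      fix k assume "k \<in> {..n} - {..n} \<inter> {..<p}"
      then show "clausen_coeff n k * coeff (clausen_arg ^ k) m = 0"
        using True coeff_clausen_arg_power_eq_0[of m k] by auto
    qed auto
    also have "\<dots> = (\<Sum>k<p. clausen_coeff n k * coeff (clausen_arg ^ k) m)"
    proof (intro sum.mono_neutral_left ballI)
      fix k assume "k \<in> {..<p} - {..n} \<inter> {..<p}"
      then show "clausen_coeff n k * coeff (clausen_arg ^ k) m = 0"
        using legendre_coeff_eq_0[of n k] by (auto simp: clausen_coeff_def)
    qed auto
    also have "\<dots> = coeff S m" by (simp add: S_def coeff_sum)
    finally show ?thesis by simp
  next
    case False
    \<comment> \<open>Only pairs i, j < p with i + j = m \<ge> p contribute.\<close>
    have "(int p)\<^sup>2 dvd coeff (T\<^sup>2) m"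
      unfolding power2_eq_square coeff_mult
      using False prime_sq_dvd_legendre_coeff_mult[OF p]
      by (intro dvd_sum) (auto simp: T power2_eq_square)
    moreover have "(int p)\<^sup>2 dvd clausen_coeff n k * coeff (clausen_arg ^ k) m" if "k < p" for k
    \<comment> \<open>If 2k < p, then w^k has degree at most 2k < m and does not reach degree
      m.\<close>
    proof (cases "p \<le> 2 * k")
      case True
      then show ?thesis using prime_sq_dvd_clausen_coeff[OF p that] by simp
    next
      case False
      have "degree (clausen_arg ^ k) \<le> 2 * k"
        using degree_power_le[of clausen_arg k] by (simp add: clausen_arg_def)
      then have "coeff (clausen_arg ^ k) m = 0"
        using False \<open>\<not> m < p\<close> by (intro coeff_eq_0) simp
      then show ?thesis by simp
    qed
    then have "(int p)\<^sup>2 dvd coeff S m"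
      unfolding S_def coeff_sum by (intro dvd_sum) simp
    ultimately show ?thesis by simp
  qed
  then have "[:(int p)\<^sup>2:] dvd T\<^sup>2 - S" by (simp add: const_poly_dvd_iff)
  then obtain q where "T\<^sup>2 - S = [:(int p)\<^sup>2:] * q" by (elim dvdE)
  then have "poly (T\<^sup>2 - S) z = (int p)\<^sup>2 * poly q z" by (simp only: poly_mult) simp
  then have "(int p)\<^sup>2 dvd poly (T\<^sup>2 - S) z" by simp
  moreover have "poly (T\<^sup>2 - S) z
      = (\<Sum>k<p. legendre_coeff n k * z ^ k)\<^sup>2 - (\<Sum>k<p. clausen_coeff n k * (z * (1 - z)) ^ k)"
    by (simp add: T_def S_def poly_sum poly_monom clausen_arg_def algebra_simps)
  ultimately show ?thesis by (simp add: cong_iff_dvd_diff)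
qed

section \<open>Components of p-adic operations as integers modulo p^m\<close>

text \<open>The congruences from here on express that evaluation at index \<open>m\<close> is a ring
  homomorphism to the integers modulo p^m, so that p-adic congruences can be checked on
  integers.\<close>

lemma padic_int_add_cong: "[(x \<oplus>\<^bsub>padic_int p\<^esub> y) m = x m + y m] (mod int p ^ m)"
  by (simp add: padic_int_def cong_def)

lemma padic_int_mult_cong: "[(x \<otimes>\<^bsub>padic_int p\<^esub> y) m = x m * y m] (mod int p ^ m)"
  by (simp add: padic_int_def cong_def)

lemma padic_int_one_cong: "[\<one>\<^bsub>padic_int p\<^esub> m = 1] (mod int p ^ m)"
  by (simp add: padic_int_def cong_def)

lemma padic_int_of_nat_cong:
  "[([k] \<cdot>\<^bsub>padic_int p\<^esub> \<one>\<^bsub>padic_int p\<^esub>) m = int k] (mod int p ^ m)"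
  by (simp add: padic_int_of_nat cong_def)

lemma padic_int_of_nat_mult_cong:
  assumes "p > 0" "x \<in> carrier (padic_int p)"
  shows "[([k] \<cdot>\<^bsub>padic_int p\<^esub> x) m = int k * x m] (mod int p ^ m)"
proof -
  interpret cring "padic_int p" using assms(1) by (rule padic_int_cring)
  have "[k] \<cdot>\<^bsub>padic_int p\<^esub> x = [k] \<cdot>\<^bsub>padic_int p\<^esub> \<one>\<^bsub>padic_int p\<^esub> \<otimes>\<^bsub>padic_int p\<^esub> x"
    using assms(2) by (simp add: add_pow_ldistr)
  then show ?thesis
    by (auto intro!: cong_trans[OF padic_int_mult_cong] cong_scalar_right padic_int_of_nat_cong)
qed

lemma padic_int_minus_cong:
  assumes "p > 0" "x \<in> carrier (padic_int p)" "y \<in> carrier (padic_int p)"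
  shows "[(x \<ominus>\<^bsub>padic_int p\<^esub> y) m = x m - y m] (mod int p ^ m)"
proof -
  interpret cring "padic_int p" using assms(1) by (rule padic_int_cring)
  \<comment> \<open>Ring subtraction is not given componentwise, so it is characterised by adding
    \<open>y\<close> back.\<close>
  have "(x \<ominus>\<^bsub>padic_int p\<^esub> y) \<oplus>\<^bsub>padic_int p\<^esub> y = x"
    using assms(2,3) by algebra
  then have "[x m = (x \<ominus>\<^bsub>padic_int p\<^esub> y) m + y m] (mod int p ^ m)"
    by (metis padic_int_add_cong)
  then show ?thesis by (simp add: cong_iff_dvd_diff algebra_simps dvd_diff_commute)
qed

lemma padic_int_pow_cong: "[(x [^]\<^bsub>padic_int p\<^esub> (k :: nat)) m = x m ^ k] (mod int p ^ m)"
proof (induction k)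
  case (Suc k)
  have "[(x [^]\<^bsub>padic_int p\<^esub> Suc k) m = (x [^]\<^bsub>padic_int p\<^esub> k) m * x m] (mod int p ^ m)"
    using padic_int_mult_cong by (simp add: nat_pow_def)
  also have "[(x [^]\<^bsub>padic_int p\<^esub> k) m * x m = x m ^ k * x m] (mod int p ^ m)"
    using Suc by (rule cong_scalar_right)
  finally show ?case by (simp add: mult.commute)
qed (simp add: nat_pow_def padic_int_one_cong)

lemma padic_int_inv_cong:
  assumes "p > 0" "x \<in> Units (padic_int p)"
  shows "[x m * (inv\<^bsub>padic_int p\<^esub> x) m = 1] (mod int p ^ m)"
proof -
  interpret cring "padic_int p" using assms(1) by (rule padic_int_cring)
  have "x \<otimes>\<^bsub>padic_int p\<^esub> inv\<^bsub>padic_int p\<^esub> x = \<one>\<^bsub>padic_int p\<^esub>"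
    using assms(2) by (rule Units_r_inv)
  then show ?thesis by (metis padic_int_mult_cong padic_int_one_cong cong_sym cong_trans)
qed

lemma padic_int_finsum_cong:
  assumes "p > 0" "finite A" "\<And>k. k \<in> A \<Longrightarrow> f k \<in> carrier (padic_int p)"
    and "\<And>k. k \<in> A \<Longrightarrow> [f k m = g k] (mod int p ^ m)"
  shows "[(\<Oplus>\<^bsub>padic_int p\<^esub>k\<in>A. f k) m = (\<Sum>k\<in>A. g k)] (mod int p ^ m)"
proof -
  interpret cring "padic_int p" using assms(1) by (rule padic_int_cring)
  show ?thesis using assms(2-)
  proof (induction A rule: finite_induct)
    case empty
    then show ?case unfolding finsum_empty by (simp add: padic_int_def)
  next
    case (insert a A)
    have "finsum (padic_int p) f (insert a A) = f a \<oplus>\<^bsub>padic_int p\<^esub> finsum (padic_int p) f A"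
      using insert by (intro finsum_insert) auto
    then show ?case
      using cong_trans[OF padic_int_add_cong cong_add, of "f a" m "g a" p "finsum (padic_int p) f A" "sum g A"] insert
      by simp
  qed
qed

lemma padic_int_pochhammer_closed:
  assumes "p > 0" "x \<in> carrier (padic_int p)"
  shows "ring_pochhammer (padic_int p) x k \<in> carrier (padic_int p)"
proof -
  interpret cring "padic_int p" using assms(1) by (rule padic_int_cring)
  show ?thesis using assms(2) by (induction k) simp_all
qed

lemma padic_int_pochhammer_cong:
  assumes "[x m = a] (mod int p ^ m)"
  shows "[ring_pochhammer (padic_int p) x k m = pochhammer a k] (mod int p ^ m)"
proof (induction k)
  case (Suc k)
  have "[(x \<oplus>\<^bsub>padic_int p\<^esub> [k] \<cdot>\<^bsub>padic_int p\<^esub> \<one>\<^bsub>padic_int p\<^esub>) m = a + int k] (mod int p ^ m)"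
    by (rule cong_trans[OF padic_int_add_cong]) (intro cong_add assms padic_int_of_nat_cong)
  with Suc show ?case
    unfolding ring_pochhammer.simps pochhammer_Suc of_nat_id
    by (intro cong_trans[OF padic_int_mult_cong] cong_mult)
qed (simp add: padic_int_one_cong)

text \<open>An equality and not just a congruence, so that lower Pochhammer symbols can be replaced
  by factorials under \<open>inv\<close>.\<close>

lemma padic_int_pochhammer_one:
  "ring_pochhammer (padic_int p) \<one>\<^bsub>padic_int p\<^esub> k = [(fact k :: nat)] \<cdot>\<^bsub>padic_int p\<^esub> \<one>\<^bsub>padic_int p\<^esub>"
  unfolding padic_int_of_nat
proof (induction k)
  case (Suc k)
  then show ?case
    unfolding ring_pochhammer.simps padic_int_of_nat
    by (simp add: padic_int_def fun_eq_iff mod_simps algebra_simps)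
qed (simp add: padic_int_def)

lemma padic_int_mod_pow:
  assumes "x \<in> carrier (padic_int p)"
  shows "x (n + m) mod int p ^ n = x n"
proof (induction m)
  case 0
  then show ?case using assms by (simp add: padic_int_def)
next
  case (Suc m)
  have "x (n + Suc m) mod int p ^ n = x (Suc (n + m)) mod int p ^ (n + m) mod int p ^ n"
    by (simp add: mod_mod_cancel le_imp_power_dvd)
  also have "x (Suc (n + m)) mod int p ^ (n + m) = x (n + m)"
    using assms by (simp add: padic_int_def)
  finally show ?case using Suc by simp
qed

text \<open>Component \<open>m\<close> alone decides: if the difference vanishes there, its later
  components are divisible by p^m, and the quotients form a p-adic integer.\<close>

lemma padic_congI:
  assumes p: "p > 0" and xy: "x \<in> carrier (padic_int p)" "y \<in> carrier (padic_int p)"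
    and eq: "[x m = y m] (mod int p ^ m)"
  shows "padic_cong p m x y"
proof -
  interpret cring "padic_int p" using p by (rule padic_int_cring)
  define d where "d = x \<ominus>\<^bsub>padic_int p\<^esub> y"
  have d: "d \<in> carrier (padic_int p)" unfolding d_def using xy by simp
  have "[d m = x m - y m] (mod int p ^ m)"
    unfolding d_def by (rule padic_int_minus_cong[OF p xy])
  then have "[d m = 0] (mod int p ^ m)"
    using eq by (metis cong_diff_iff_cong_0 cong_trans)
  then have dm: "d m = 0" using padic_int_mod_pow[OF d, of m 0] by (simp add: cong_def)
  \<comment> \<open>Division by p^m costs m digits of precision, hence the shift of the
    index.\<close>
  define q where "q n = d (n + m) div int p ^ m" for n
  have dq: "int p ^ m * q n = d (n + m)" for n
  proof -
    have "d (m + n) mod int p ^ m = 0" using padic_int_mod_pow[OF d, of m n] dm by simp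
    then show ?thesis by (simp add: q_def add.commute mod_0_imp_dvd)
  qed
  have "q n \<in> {0..<int p ^ n}" for n
  proof -
    have "d (n + m) \<in> {0..<int p ^ (n + m)}" using d by (simp add: padic_int_def)
    then have "0 \<le> int p ^ m * q n" "int p ^ m * q n < int p ^ m * int p ^ n"
      unfolding dq by (simp_all add: power_add mult.commute)
    moreover have "int p ^ m > 0" using p by simp
    ultimately show ?thesis by (simp add: zero_le_mult_iff)
  qed
  moreover have "q (Suc n) mod int p ^ n = q n" for n
  proof -
    \<comment> \<open>After multiplication by p^m, coherence of \<open>q\<close> becomes coherence
      of \<open>d\<close> between levels n + m + 1 and n + m.\<close>
    have "int p ^ m * (q (Suc n) mod int p ^ n) = int p ^ m * q (Suc n) mod (int p ^ m * int p ^ n)"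
      by (rule mult_mod_right)
    also have "\<dots> = d (n + m)"
    proof -
      have "d (Suc (n + m)) mod int p ^ (n + m) = d (n + m)"
        using d by (simp add: padic_int_def)
      then show ?thesis unfolding dq by (simp add: power_add mult.commute)
    qed
    finally show ?thesis using p by (simp flip: dq)
  qed
  ultimately have q: "q \<in> carrier (padic_int p)" by (simp add: padic_int_def)
  have "d n = (q \<otimes>\<^bsub>padic_int p\<^esub> ([(p ^ m)] \<cdot>\<^bsub>padic_int p\<^esub> \<one>\<^bsub>padic_int p\<^esub>)) n" for n
    unfolding padic_int_of_nat using padic_int_mod_pow[OF d, of n m] dq[of n]
    by (simp add: padic_int_def mod_simps mult.commute)
  then have "d = q \<otimes>\<^bsub>padic_int p\<^esub> ([(p ^ m)] \<cdot>\<^bsub>padic_int p\<^esub> \<one>\<^bsub>padic_int p\<^esub>)" ..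
  then show ?thesis
    using q unfolding padic_cong_def d_def[symmetric] cgenideal_def by auto
qed

section \<open>The summands of both series modulo M\<close>

text \<open>\<open>h\<close> stands for 1/2 modulo \<open>M\<close>. The induction step multiplies
  by 4(h + k)(k + 1), which is congruent to (2k + 1)(2k + 2).\<close>

lemma pochhammer_half_cong:
  fixes h M :: int
  assumes "[2 * h = 1] (mod M)"
  shows "[4 ^ k * pochhammer h k * fact k = fact (2 * k)] (mod M)"
proof (induction k)
  case (Suc k)
  have "[2 * (2 * h) + 4 * int k = 2 * 1 + 4 * int k] (mod M)"
    using assms by (intro cong_add cong_mult cong_refl)
  then have "[4 ^ k * pochhammer h k * fact k * (2 * (2 * h) + 4 * int k) * (int k + 1)
      = fact (2 * k) * (2 * 1 + 4 * int k) * (int k + 1)] (mod M)"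
    using Suc by (intro cong_mult cong_refl)
  then show ?case by (simp add: pochhammer_Suc algebra_simps)
qed simp

text \<open>\<open>I\<close> and \<open>J\<close> represent the inverses of (1)_k and of the k! in
  the series. Multiplying by (k!)^2 removes both, and this factor is cancelled at the end.\<close>

lemma legendre_coeff_padic_cong:
  fixes a b I J z t M :: int
  assumes M: "coprime (fact k) M"
    and a: "[a = pochhammer (- int n) k] (mod M)" and b: "[b = pochhammer (1 + int n) k] (mod M)"
    and I: "[fact k * I = 1] (mod M)" and J: "[fact k * J = 1] (mod M)"
    and t: "[t = a * b * I * (z ^ k * J)] (mod M)"
  shows "[t = legendre_coeff n k * z ^ k] (mod M)"
proof -
  have "[(fact k)\<^sup>2 * t = (fact k)\<^sup>2 * (a * b * I * (z ^ k * J))] (mod M)"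
    using t by (rule cong_scalar_left)
  also have "(fact k)\<^sup>2 * (a * b * I * (z ^ k * J)) = (fact k * I) * (fact k * J) * (a * b) * z ^ k"
    by (simp add: power2_eq_square mult_ac)
  also have "[(fact k * I) * (fact k * J) * (a * b) * z ^ k
      = 1 * 1 * (pochhammer (- int n) k * pochhammer (1 + int n) k) * z ^ k] (mod M)"
    using a b I J by (intro cong_mult cong_refl)
  also have "1 * 1 * (pochhammer (- int n) k * pochhammer (1 + int n) k) * z ^ k = (fact k)\<^sup>2 * (legendre_coeff n k * z ^ k)"
    by (simp add: fact_sq_legendre_coeff[symmetric] mult_ac)
  finally show ?thesis using M by (simp add: cong_mult_lcancel)
qed

text \<open>The scaling factor is (k!)^4: the inverses \<open>I\<close> and \<open>J\<close> use up
  three factors k!, and the fourth combines with 4^k and the Pochhammer symbol of 1/2 to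
  (2k)!.\<close>

lemma clausen_coeff_padic_cong:
  fixes a b c h I J w t M :: int
  assumes M: "coprime (fact k) M"
    and a: "[a = pochhammer (- int n) k] (mod M)" and b: "[b = pochhammer (1 + int n) k] (mod M)"
    and h: "[2 * h = 1] (mod M)" and c: "[c = pochhammer h k] (mod M)"
    and I: "[(fact k)\<^sup>2 * I = 1] (mod M)" and J: "[fact k * J = 1] (mod M)"
    and t: "[t = a * b * c * I * ((4 * w) ^ k * J)] (mod M)"
  shows "[t = clausen_coeff n k * w ^ k] (mod M)"
proof -
  have "[(fact k) ^ 4 * t = (fact k) ^ 4 * (a * b * c * I * ((4 * w) ^ k * J))] (mod M)"
    using t by (rule cong_scalar_left)
  also have "(fact k) ^ 4 * (a * b * c * I * ((4 * w) ^ k * J))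
      = ((fact k)\<^sup>2 * I) * (fact k * J) * (a * b) * (4 ^ k * c * fact k) * w ^ k"
    by (simp add: eval_nat_numeral power_mult_distrib mult_ac)
  also have "[((fact k)\<^sup>2 * I) * (fact k * J) * (a * b) * (4 ^ k * c * fact k) * w ^ k
      = 1 * 1 * (pochhammer (- int n) k * pochhammer (1 + int n) k)
      * (4 ^ k * pochhammer h k * fact k) * w ^ k] (mod M)"
    using a b c I J by (intro cong_mult cong_refl)
  also have "[1 * 1 * (pochhammer (- int n) k * pochhammer (1 + int n) k)
      * (4 ^ k * pochhammer h k * fact k) * w ^ k
      = 1 * 1 * (pochhammer (- int n) k * pochhammer (1 + int n) k)
      * fact (2 * k) * w ^ k] (mod M)"
    by (intro cong_mult cong_refl pochhammer_half_cong h)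
  also have "fact (2 * k) = (fact k)\<^sup>2 * int ((2 * k) choose k)"
    by (metis fact_sq_central_binomial of_nat_fact of_nat_mult of_nat_power)
  also have "1 * 1 * (pochhammer (- int n) k * pochhammer (1 + int n) k)
      * ((fact k)\<^sup>2 * int ((2 * k) choose k)) * w ^ k = (fact k) ^ 4 * (clausen_coeff n k * w ^ k)"
    by (simp add: fact_sq_legendre_coeff[symmetric] clausen_coeff_def eval_nat_numeral mult_ac)
  finally show ?thesis using M by (simp add: cong_mult_lcancel)
qed

section \<open>The congruence for p-adic parameters\<close>

theorem theorem2p2:
  fixes p :: nat and \<alpha> z :: "nat \<Rightarrow> int"
  assumes "prime p" and "odd p"
    and "\<alpha> \<in> carrier (padic_int p)" and "z \<in> carrier (padic_int p)"
  shows "let R = padic_int p in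
    padic_cong p 2
      ((hypergeom_trunc R [\<alpha>, \<one>\<^bsub>R\<^esub> \<ominus>\<^bsub>R\<^esub> \<alpha>] [\<one>\<^bsub>R\<^esub>] z (p - 1)) [^]\<^bsub>R\<^esub> (2 :: nat))
      (hypergeom_trunc R
        [\<alpha>, \<one>\<^bsub>R\<^esub> \<ominus>\<^bsub>R\<^esub> \<alpha>, inv\<^bsub>R\<^esub> ([(2 :: nat)] \<cdot>\<^bsub>R\<^esub> \<one>\<^bsub>R\<^esub>)]
        [\<one>\<^bsub>R\<^esub>, \<one>\<^bsub>R\<^esub>]
        ([(4 :: nat)] \<cdot>\<^bsub>R\<^esub> (z \<otimes>\<^bsub>R\<^esub> (\<one>\<^bsub>R\<^esub> \<ominus>\<^bsub>R\<^esub> z)))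
        (p - 1))"
proof -
  define R where "R = padic_int p"
  have p: "p > 0" using assms(1) by (rule prime_gt_0_nat)
  interpret R: cring R unfolding R_def using p by (rule padic_int_cring)
  note [simp] = assms(3,4)[folded R_def]
  define M where "M = int p ^ 2"
  \<comment> \<open>Everything below is read at index 2, that is, modulo p^2.\<close>
  note mult_cong = padic_int_mult_cong[of p _ _ 2, folded R_def M_def]
  note minus_cong = padic_int_minus_cong[OF p, of _ _ 2, folded R_def M_def]
  note one_cong = padic_int_one_cong[of p 2, folded R_def M_def]
  note pow_cong = padic_int_pow_cong[of p _ _ 2, folded R_def M_def]
  note nat_cong = padic_int_of_nat_cong[of p _ 2, folded R_def M_def]
  note nat_mult_cong = padic_int_of_nat_mult_cong[OF p, of _ _ 2, folded R_def M_def]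
  note inv_cong = padic_int_inv_cong[OF p, of _ 2, folded R_def M_def]
  note poch_cong = padic_int_pochhammer_cong[of _ 2 _ p, folded R_def M_def]
  note sum_cong = padic_int_finsum_cong[OF p, of _ _ 2, folded R_def M_def]
  note poch_closed [simp] = padic_int_pochhammer_closed[OF p, folded R_def]
  note poch_one = padic_int_pochhammer_one[of p, folded R_def]
  note units = padic_int_of_nat_Units[OF p, folded R_def]

  define \<beta> where "\<beta> = \<one>\<^bsub>R\<^esub> \<ominus>\<^bsub>R\<^esub> \<alpha>"
  define two where "two = [(2 :: nat)] \<cdot>\<^bsub>R\<^esub> \<one>\<^bsub>R\<^esub>"
  define w where "w = z \<otimes>\<^bsub>R\<^esub> (\<one>\<^bsub>R\<^esub> \<ominus>\<^bsub>R\<^esub> z)"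
  define F where "F k = [(fact k :: nat)] \<cdot>\<^bsub>R\<^esub> \<one>\<^bsub>R\<^esub>" for k
  have [simp]: "\<beta> \<in> carrier R" "w \<in> carrier R" by (simp_all add: \<beta>_def w_def)
  \<comment> \<open>Oddness of \<open>p\<close> makes 2 a unit, so the inverse of \<open>two\<close>
    is a genuine 1/2.\<close>
  have two: "two \<in> Units R" unfolding two_def using assms(2) by (intro units) simp
  then have [simp]: "inv\<^bsub>R\<^esub> two \<in> carrier R" by simp
  have fact_coprime: "coprime (fact k) p" if "k < p" for k
    using assms(1) that
    by (simp add: coprime_commute prime_imp_coprime prime_dvd_fact_iff)
  then have F: "F k \<in> Units R" if "k < p" for k
    unfolding F_def using that by (intro units)
  have F_cong: "[F k 2 = fact k] (mod M)" for k
    unfolding F_def using nat_cong[of "fact k"] by simp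
  have coprime_M: "coprime (fact k) M" if "k < p" for k
  proof -
    have "coprime (int (fact k)) (int p)"
      using fact_coprime[OF that] by (simp only: coprime_int_iff)
    then show ?thesis by (simp add: M_def)
  qed

  \<comment> \<open>This makes -n congruent to \<open>\<alpha>\<close> modulo p^2;
    \<open>nat\<close> loses nothing because the representative \<open>\<alpha> 2\<close> is below
    \<open>M\<close>.\<close>
  define n where "n = nat (M - \<alpha> 2)"
  have "\<alpha> 2 < M" using assms(3) by (simp add: padic_int_def M_def)
  then have n: "int n = M - \<alpha> 2" by (simp add: n_def)
  have \<alpha>: "[\<alpha> 2 = - int n] (mod M)" by (simp add: n cong_iff_dvd_diff)
  have \<beta>: "[\<beta> 2 = 1 + int n] (mod M)"
  proof -
    have "[\<beta> 2 = \<one>\<^bsub>R\<^esub> 2 - \<alpha> 2] (mod M)" unfolding \<beta>_def by (rule minus_cong) simp_all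
    also have "[\<one>\<^bsub>R\<^esub> 2 - \<alpha> 2 = 1 - (- int n)] (mod M)" by (intro cong_diff one_cong \<alpha>)
    finally show ?thesis by simp
  qed
  have w: "[w 2 = z 2 * (1 - z 2)] (mod M)"
  proof -
    have "[w 2 = z 2 * (\<one>\<^bsub>R\<^esub> \<ominus>\<^bsub>R\<^esub> z) 2] (mod M)" unfolding w_def by (rule mult_cong)
    also have "[z 2 * (\<one>\<^bsub>R\<^esub> \<ominus>\<^bsub>R\<^esub> z) 2 = z 2 * (\<one>\<^bsub>R\<^esub> 2 - z 2)] (mod M)"
      by (intro cong_mult cong_refl minus_cong) simp_all
    also have "[z 2 * (\<one>\<^bsub>R\<^esub> 2 - z 2) = z 2 * (1 - z 2)] (mod M)"
      by (intro cong_mult cong_diff cong_refl one_cong)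
    finally show ?thesis .
  qed
  have half: "[2 * (inv\<^bsub>R\<^esub> two) 2 = 1] (mod M)"
  proof -
    have "[2 * (inv\<^bsub>R\<^esub> two) 2 = two 2 * (inv\<^bsub>R\<^esub> two) 2] (mod M)"
      unfolding two_def using nat_cong[of 2] by (intro cong_mult cong_refl) (simp add: cong_sym)
    also have "[two 2 * (inv\<^bsub>R\<^esub> two) 2 = 1] (mod M)" using two by (rule inv_cong)
    finally show ?thesis .
  qed
  have F_inv: "[fact k * (inv\<^bsub>R\<^esub> F k) 2 = 1] (mod M)" if "k < p" for k
    using cong_trans[OF cong_sym[OF cong_scalar_right[OF F_cong]] inv_cong[OF F[OF that]]] .

  let ?P = "\<lambda>x k. ring_pochhammer R x k"
  have P_cong: "[?P \<alpha> k 2 = pochhammer (- int n) k] (mod M)" "[?P \<beta> k 2 = pochhammer (1 + int n) k] (mod M)"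
      "[?P (inv\<^bsub>R\<^esub> two) k 2 = pochhammer ((inv\<^bsub>R\<^esub> two) 2) k] (mod M)" for k
    by (rule poch_cong; simp add: \<alpha> \<beta>)+
  \<comment> \<open>\<open>s\<close> and \<open>t\<close> keep the trailing ones that
    \<open>foldr\<close> in \<open>list_pochhammer\<close> produces, to match the unfolded
    summands.\<close>
  define s where "s k = ((?P \<alpha> k \<otimes>\<^bsub>R\<^esub> (?P \<beta> k \<otimes>\<^bsub>R\<^esub> \<one>\<^bsub>R\<^esub>)) \<otimes>\<^bsub>R\<^esub> inv\<^bsub>R\<^esub> (F k \<otimes>\<^bsub>R\<^esub> \<one>\<^bsub>R\<^esub>))
      \<otimes>\<^bsub>R\<^esub> (z [^]\<^bsub>R\<^esub> k \<otimes>\<^bsub>R\<^esub> inv\<^bsub>R\<^esub> F k)" for k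
  define t where "t k = ((?P \<alpha> k \<otimes>\<^bsub>R\<^esub> (?P \<beta> k \<otimes>\<^bsub>R\<^esub> (?P (inv\<^bsub>R\<^esub> two) k \<otimes>\<^bsub>R\<^esub> \<one>\<^bsub>R\<^esub>)))
      \<otimes>\<^bsub>R\<^esub> inv\<^bsub>R\<^esub> (F k \<otimes>\<^bsub>R\<^esub> (F k \<otimes>\<^bsub>R\<^esub> \<one>\<^bsub>R\<^esub>)))
      \<otimes>\<^bsub>R\<^esub> (([(4 :: nat)] \<cdot>\<^bsub>R\<^esub> w) [^]\<^bsub>R\<^esub> k \<otimes>\<^bsub>R\<^esub> inv\<^bsub>R\<^esub> F k)" for k
  have S: "hypergeom_trunc R [\<alpha>, \<beta>] [\<one>\<^bsub>R\<^esub>] z (p - 1) = (\<Oplus>\<^bsub>R\<^esub>k\<in>{0..p - 1}. s k)"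
    by (simp add: hypergeom_trunc_def list_pochhammer_def s_def F_def poch_one)
  have T: "hypergeom_trunc R [\<alpha>, \<beta>, inv\<^bsub>R\<^esub> two] [\<one>\<^bsub>R\<^esub>, \<one>\<^bsub>R\<^esub>] ([(4 :: nat)] \<cdot>\<^bsub>R\<^esub> w) (p - 1)
      = (\<Oplus>\<^bsub>R\<^esub>k\<in>{0..p - 1}. t k)"
    by (simp add: hypergeom_trunc_def list_pochhammer_def t_def F_def poch_one)
  have F': "F k \<in> carrier R" "inv\<^bsub>R\<^esub> F k \<in> carrier R" "inv\<^bsub>R\<^esub> (F k \<otimes>\<^bsub>R\<^esub> F k) \<in> carrier R"
    if "k < p" for k
    using F[OF that] by (simp_all add: R.Units_closed)
  have s: "s k \<in> carrier R \<and> [s k 2 = legendre_coeff n k * z 2 ^ k] (mod M)" if k: "k < p" for k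
  proof
    note Fk = F'[OF k]
    have s_eq: "s k = ?P \<alpha> k \<otimes>\<^bsub>R\<^esub> ?P \<beta> k \<otimes>\<^bsub>R\<^esub> inv\<^bsub>R\<^esub> F k \<otimes>\<^bsub>R\<^esub> (z [^]\<^bsub>R\<^esub> k \<otimes>\<^bsub>R\<^esub> inv\<^bsub>R\<^esub> F k)"
      using Fk by (simp add: s_def)
    show "s k \<in> carrier R" using Fk by (simp add: s_eq)
    have "[s k 2 = ?P \<alpha> k 2 * ?P \<beta> k 2 * (inv\<^bsub>R\<^esub> F k) 2 * (z 2 ^ k * (inv\<^bsub>R\<^esub> F k) 2)] (mod M)"
      unfolding s_eq by (intro cong_trans[OF mult_cong] cong_mult cong_refl pow_cong mult_cong)
    then show "[s k 2 = legendre_coeff n k * z 2 ^ k] (mod M)"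
      by (rule legendre_coeff_padic_cong[OF coprime_M[OF k] P_cong(1,2)
            F_inv[OF k] F_inv[OF k]])
  qed
  have t: "t k \<in> carrier R \<and> [t k 2 = clausen_coeff n k * (z 2 * (1 - z 2)) ^ k] (mod M)"
    if k: "k < p" for k
  proof
    note Fk = F'[OF k]
    have t_eq: "t k = ?P \<alpha> k \<otimes>\<^bsub>R\<^esub> ?P \<beta> k \<otimes>\<^bsub>R\<^esub> ?P (inv\<^bsub>R\<^esub> two) k \<otimes>\<^bsub>R\<^esub> inv\<^bsub>R\<^esub> (F k \<otimes>\<^bsub>R\<^esub> F k)
        \<otimes>\<^bsub>R\<^esub> (([(4 :: nat)] \<cdot>\<^bsub>R\<^esub> w) [^]\<^bsub>R\<^esub> k \<otimes>\<^bsub>R\<^esub> inv\<^bsub>R\<^esub> F k)"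
      using Fk by (simp add: t_def R.m_assoc)
    show "t k \<in> carrier R" using Fk by (simp add: t_eq)
    have "[([(4 :: nat)] \<cdot>\<^bsub>R\<^esub> w) 2 = int 4 * w 2] (mod M)" by (rule nat_mult_cong) simp
    also have "[int 4 * w 2 = 4 * (z 2 * (1 - z 2))] (mod M)"
      using w by (simp add: cong_scalar_left)
    finally have w4: "[(([(4 :: nat)] \<cdot>\<^bsub>R\<^esub> w) [^]\<^bsub>R\<^esub> k) 2 = (4 * (z 2 * (1 - z 2))) ^ k] (mod M)"
      by (intro cong_trans[OF pow_cong] cong_pow)
    have "[(fact k)\<^sup>2 * (inv\<^bsub>R\<^esub> (F k \<otimes>\<^bsub>R\<^esub> F k)) 2 = (F k \<otimes>\<^bsub>R\<^esub> F k) 2 * (inv\<^bsub>R\<^esub> (F k \<otimes>\<^bsub>R\<^esub> F k)) 2] (mod M)"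
      unfolding power2_eq_square
      by (intro cong_mult cong_refl cong_sym[OF cong_trans[OF mult_cong]] F_cong)
    also have "[(F k \<otimes>\<^bsub>R\<^esub> F k) 2 * (inv\<^bsub>R\<^esub> (F k \<otimes>\<^bsub>R\<^esub> F k)) 2 = 1] (mod M)"
      using F[OF k] by (intro inv_cong) simp
    finally have FF: "[(fact k)\<^sup>2 * (inv\<^bsub>R\<^esub> (F k \<otimes>\<^bsub>R\<^esub> F k)) 2 = 1] (mod M)" .
    have "[t k 2 = ?P \<alpha> k 2 * ?P \<beta> k 2 * ?P (inv\<^bsub>R\<^esub> two) k 2 * (inv\<^bsub>R\<^esub> (F k \<otimes>\<^bsub>R\<^esub> F k)) 2
        * ((4 * (z 2 * (1 - z 2))) ^ k * (inv\<^bsub>R\<^esub> F k) 2)] (mod M)"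
      unfolding t_eq by (intro cong_trans[OF mult_cong] cong_mult cong_refl w4 mult_cong)
    then show "[t k 2 = clausen_coeff n k * (z 2 * (1 - z 2)) ^ k] (mod M)"
      by (rule clausen_coeff_padic_cong[OF coprime_M[OF k] P_cong(1,2)
            half P_cong(3) FF F_inv[OF k]])
  qed
  have lt: "k < p" if "k \<in> {0..p - 1}" for k using that p by auto
  have range: "{0..p - 1} = {..<p}" using p by auto
  have S_cong: "[(\<Oplus>\<^bsub>R\<^esub>k\<in>{0..p - 1}. s k) 2 = (\<Sum>k<p. legendre_coeff n k * z 2 ^ k)] (mod M)"
    unfolding range[symmetric] using s lt by (intro sum_cong) auto
  have T_cong: "[(\<Oplus>\<^bsub>R\<^esub>k\<in>{0..p - 1}. t k) 2
      = (\<Sum>k<p. clausen_coeff n k * (z 2 * (1 - z 2)) ^ k)] (mod M)"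
    unfolding range[symmetric] using t lt by (intro sum_cong) auto
  have "[((\<Oplus>\<^bsub>R\<^esub>k\<in>{0..p - 1}. s k) [^]\<^bsub>R\<^esub> (2 :: nat)) 2
      = (\<Sum>k<p. legendre_coeff n k * z 2 ^ k)\<^sup>2] (mod M)"
    by (rule cong_trans[OF pow_cong]) (rule cong_pow[OF S_cong])
  \<comment> \<open>At index 2 both sides have become integer sums, and the truncated congruence
    applies to the integer \<open>z 2\<close>.\<close>
  also have "[(\<Sum>k<p. legendre_coeff n k * z 2 ^ k)\<^sup>2
      = (\<Sum>k<p. clausen_coeff n k * (z 2 * (1 - z 2)) ^ k)] (mod M)"
    unfolding M_def by (rule clausen_truncated_cong[OF assms(1)])
  also have "[(\<Sum>k<p. clausen_coeff n k * (z 2 * (1 - z 2)) ^ k) = (\<Oplus>\<^bsub>R\<^esub>k\<in>{0..p - 1}. t k) 2] (mod M)"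
    using T_cong by (rule cong_sym)
  finally have "padic_cong p 2 ((\<Oplus>\<^bsub>R\<^esub>k\<in>{0..p - 1}. s k) [^]\<^bsub>R\<^esub> (2 :: nat)) (\<Oplus>\<^bsub>R\<^esub>k\<in>{0..p - 1}. t k)"
    using s t lt unfolding M_def R_def
    by (intro padic_congI p R.nat_pow_closed[unfolded R_def] R.finsum_closed[unfolded R_def]) auto
  then show ?thesis
    unfolding Let_def R_def[symmetric] \<beta>_def[symmetric] two_def[symmetric] w_def[symmetric] S T .
qed

end
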